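(* Let $X$ be a rack and let $Q\colon C^n(X;X)\to C^{n+1}(X;X)$ ($n\ge0$) be defined by $$Q(F)=P(F)+(-1)^{n+1}F\cup\Lambda .$$ Then $Q^2=0$.
   Context: A rack is a set $X$ with operation $*$ such that for all $a,b$ there is a unique $c$ with $a=c*b$, and $(a*b)*c=(a*c)*(b*c)$. Fix a commutative coefficient ring. $C^n(X;X)$ denotes functions on $X\times X^n$, whose elements are written $(y;x_1,\dots,x_n)$. Face maps: $\delta^0_i(y;x_1,\dots,x_n)=(y;x_1,\dots,x_{i-1},x_{i+1},\dots,x_n)$, $\delta^1_i(y;x_1,\dots,x_n)=(y*x_i;x_1*x_i,\dots,x_{i-1}*x_i,x_{i+1},\dots,x_n)$. Cup product: for $f\in C^k$, $g\in C^m$, $n=k+m$, $(f\cup g)(z)=(-1)^{km}\sum_A\epsilon(A)f(\delta^0_Az)g(\delta^1_Bz)$, the sum over subsets $A=\{a_1<\dots<a_m\}\subseteq\{1,\dots,n\}$ with complement $B=\{b_1<\dots<b_k\}$; $\epsilon(A)$ is the sign of the permutation sending $(1,\dots,n)$ to $(b_1,\dots,b_k,a_1,\dots,a_m)$, $\delta^0_A=\delta^0_{a_1}\circ\dots\circ\delta^0_{a_m}$, $\delta^1_B=\delta^1_{b_1}\circ\dots\circ\delta^1_{b_k}$. $P\colon C^k(X;X)\to C^{k+1}(X;X)$ is $(PF)(x_0;x_1,\dots,x_{k+1})=(-1)^kF(x_1;x_2,\dots,x_{k+1})$. $\Lambda=P(\mathbf 1)\in C^1(X;X)$, where $\mathbf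 1$ is the constant $0$-cochain $1$; thus $\Lambda(y;x)=1$ for all $y,x\in X$. *)

theory Defs
  imports "HOL-Combinatorics.Permutations" "HOL-Library.FuncSet"
begin

definition rack :: "'a set \<Rightarrow> ('a \<Rightarrow> 'a \<Rightarrow> 'a) \<Rightarrow> bool" where
  "rack X op \<longleftrightarrow>
     (\<forall>a\<in>X. \<forall>b\<in>X. op a b \<in> X) \<and>
     (\<forall>a\<in>X. \<forall>b\<in>X. \<exists>!c. c \<in> X \<and> a = op c b) \<and>
     (\<forall>a\<in>X. \<forall>b\<in>X. \<forall>c\<in>X. op (op a b) c = op (op a c) (op b c))"

text \<open>The element \<open>(y; x\<^sub>1, \<dots>, x\<^sub>n)\<close> of \<open>X \<times> X^n\<close> is the pair \<open>(y, [x\<^sub>1, \<dots>, x\<^sub>n])\<close>.\<close>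

definition cells :: "'a set \<Rightarrow> nat \<Rightarrow> ('a \<times> 'a list) set" where
  "cells X n = X \<times> {xs. set xs \<subseteq> X \<and> length xs = n}"

text \<open>Cochains are extensional functions, so that equality in \<open>C^n(X;X)\<close> is HOL equality; every
  operation below therefore restricts its result to the appropriate set of cells.\<close>

definition cochains :: "'a set \<Rightarrow> nat \<Rightarrow> ('a \<times> 'a list \<Rightarrow> 'r::comm_ring_1) set" where
  "cochains X n = cells X n \<rightarrow>\<^sub>E UNIV"

definition zero_cochain :: "'a set \<Rightarrow> nat \<Rightarrow> 'a \<times> 'a list \<Rightarrow> 'r::comm_ring_1" where
  "zero_cochain X n = (\<lambda>z\<in>cells X n. 0)"

definition one_cochain :: "'a set \<Rightarrow> 'a \<times> 'a list \<Rightarrow> 'r::comm_ring_1" where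
  "one_cochain X = (\<lambda>z\<in>cells X 0. 1)"

text \<open>Face indices start at 1, whereas list positions start at 0.\<close>

fun face0 :: "nat \<Rightarrow> 'a \<times> 'a list \<Rightarrow> 'a \<times> 'a list" where
  "face0 i (y, xs) = (y, take (i - 1) xs @ drop i xs)"

fun face1 :: "('a \<Rightarrow> 'a \<Rightarrow> 'a) \<Rightarrow> nat \<Rightarrow> 'a \<times> 'a list \<Rightarrow> 'a \<times> 'a list" where
  "face1 op i (y, xs) =
     (let x = xs ! (i - 1) in (op y x, map (\<lambda>u. op u x) (take (i - 1) xs) @ drop i xs))"

text \<open>For \<open>A = {a\<^sub>1 < \<dots> < a\<^sub>m}\<close> these are the composites \<open>\<delta>_{a\<^sub>1} \<circ> \<dots> \<circ> \<delta>_{a\<^sub>m}\<close>: the face with the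
  largest index is applied first.\<close>

definition faces0 :: "nat set \<Rightarrow> 'a \<times> 'a list \<Rightarrow> 'a \<times> 'a list" where
  "faces0 A z = foldr face0 (sorted_list_of_set A) z"

definition faces1 :: "('a \<Rightarrow> 'a \<Rightarrow> 'a) \<Rightarrow> nat set \<Rightarrow> 'a \<times> 'a list \<Rightarrow> 'a \<times> 'a list" where
  "faces1 op A z = foldr (face1 op) (sorted_list_of_set A) z"

text \<open>With \<open>B = {1..n} - A\<close>, this is the map \<open>(1, \<dots>, n) \<mapsto> (b\<^sub>1, \<dots>, b\<^sub>k, a\<^sub>1, \<dots>, a\<^sub>m)\<close>, extended by
  the identity outside \<open>{1..n}\<close>.\<close>

definition shuffle_perm :: "nat \<Rightarrow> nat set \<Rightarrow> nat \<Rightarrow> nat" where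
  "shuffle_perm n A i =
     (if i \<in> {1..n}
      then (sorted_list_of_set ({1..n} - A) @ sorted_list_of_set A) ! (i - 1)
      else i)"

definition cup :: "'a set \<Rightarrow> ('a \<Rightarrow> 'a \<Rightarrow> 'a) \<Rightarrow> nat \<Rightarrow> nat \<Rightarrow>
    ('a \<times> 'a list \<Rightarrow> 'r) \<Rightarrow> ('a \<times> 'a list \<Rightarrow> 'r) \<Rightarrow> 'a \<times> 'a list \<Rightarrow> 'r::comm_ring_1" where
  "cup X op k m f g = (\<lambda>z\<in>cells X (k + m).
     (-1) ^ (k * m) *
     (\<Sum>A | A \<subseteq> {1..k + m} \<and> card A = m.
        of_int (sign (shuffle_perm (k + m) A)) *
        f (faces0 A z) * g (faces1 op ({1..k + m} - A) z)))"

definition P :: "'a set \<Rightarrow> nat \<Rightarrow> ('a \<times> 'a list \<Rightarrow> 'r) \<Rightarrow> 'a \<times> 'a list \<Rightarrow> 'r::comm_ring_1" where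
  "P X k F = (\<lambda>z\<in>cells X (k + 1). (-1) ^ k * F (hd (snd z), tl (snd z)))"

definition Lam :: "'a set \<Rightarrow> 'a \<times> 'a list \<Rightarrow> 'r::comm_ring_1" where
  "Lam X = P X 0 (one_cochain X)"

definition Q :: "'a set \<Rightarrow> ('a \<Rightarrow> 'a \<Rightarrow> 'a) \<Rightarrow> nat \<Rightarrow>
    ('a \<times> 'a list \<Rightarrow> 'r) \<Rightarrow> 'a \<times> 'a list \<Rightarrow> 'r::comm_ring_1" where
  "Q X op n F = (\<lambda>z\<in>cells X (n + 1). P X n F z + (-1) ^ (n + 1) * cup X op n 1 F (Lam X) z)"

lemma Lam_eq_1: "y \<in> X \<Longrightarrow> x \<in> X \<Longrightarrow> Lam X (y, [x]) = 1"
  by (simp add: Lam_def P_def one_cochain_def cells_def)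

lemma Q_in_cochains: "Q X op n F \<in> cochains X (n + 1)"
  by (simp add: Q_def cochains_def PiE_def)

end

theory Submission
  imports Defs
begin

text \<open>Up to the global sign \<open>(-1)^n\<close>, the operator \<open>Q\<close> is the simplicial coboundary on
  \<open>X^(n+1)\<close>. Read a cell \<open>(y; x\<^sub>1, \<dots>, x\<^sub>n)\<close> as the list of vertices \<open>x\<^sub>0 = y, x\<^sub>1, \<dots>, x\<^sub>n\<close>.
  Since \<open>\<Lambda>\<close> is constantly \<open>1\<close>, the second factor of \<open>F \<union> \<Lambda>\<close> disappears and with it all
  dependence on the rack operation: the summand for \<open>A = {a}\<close> is \<open>F\<close> evaluated with \<open>x\<^sub>a\<close>
  omitted, weighted by the sign of the cycle that moves \<open>a\<close> to the last place. The
  term \<open>P(F)\<close> supplies the missing face, the one omitting \<open>x\<^sub>0\<close>, and all the signs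
  combine to \<open>(-1)^n (-1)^a\<close> for the omission of \<open>x\<^sub>a\<close> with \<open>0 \<le> a \<le> n + 1\<close>
  (\<open>Q_eq_alternating_sum\<close>). Then \<open>Q\<^sup>2 = 0\<close> is the familiar cancellation in pairs of the
  iterated alternating face sum (\<open>alternating_sum_omit_omit\<close>).\<close>

section \<open>Iterated alternating face sums\<close>

definition omit :: "nat \<Rightarrow> 'a list \<Rightarrow> 'a list" where
  "omit a w = take a w @ drop (Suc a) w"

lemma length_omit: "a < length w \<Longrightarrow> length (omit a w) = length w - 1"
  by (simp add: omit_def)

lemma set_omit_subset: "set (omit a w) \<subseteq> set w"
  by (auto simp: omit_def dest: in_set_takeD in_set_dropD)

lemma nth_omit:
  assumes "a < length w" and "i < length w - 1"
  shows "omit a w ! i = w ! (if i < a then i else Suc i)"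
  using assms by (auto simp: omit_def nth_append min_def)

text \<open>The simplicial identity: when the earlier vertex goes first, the later one has moved down by
  one place.\<close>

lemma omit_omit:
  assumes "b \<le> a" and "Suc a < length w"
  shows "omit b (omit (Suc a) w) = omit a (omit b w)"
  using assms by (intro nth_equalityI) (auto simp: length_omit nth_omit)

text \<open>The simplicial identity matches the terms with \<open>b < a\<close> to those with \<open>a \<le> b\<close>, and matched
  terms have opposite signs. Both halves of the sum are compared explicitly, because in
  characteristic \<open>2\<close> it would not suffice to show that the sum equals its own negative.\<close>

lemma alternating_sum_omit_omit:
  fixes G :: "'a list \<Rightarrow> 'r::comm_ring_1"
  assumes "length w = Suc (Suc m)"
  shows "(\<Sum>a\<le>Suc m. (-1) ^ a * (\<Sum>b\<le>m. (-1) ^ b * G (omit b (omit a w)))) = 0"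
proof -
  let ?t = "\<lambda>(a, b). (-1) ^ a * ((-1) ^ b * G (omit b (omit a w)))"
  let ?I = "{..Suc m} \<times> {..m}"
  let ?L = "{(a, b) \<in> ?I. b < a}" and ?R = "{(a, b) \<in> ?I. a \<le> b}"
  have "sum ?t ?L = (\<Sum>p\<in>?R. - ?t p)"
    by (rule sum.reindex_bij_witness
          [where i = "\<lambda>(a, b). (Suc b, a)" and j = "\<lambda>(a, b). (b, a - 1)"])
       (use assms in \<open>auto simp: gr0_conv_Suc less_Suc_eq_le Suc_le_eq omit_omit mult.left_commute
          elim!: less_natE\<close>)
  then have cancel: "sum ?t ?L + sum ?t ?R = 0"
    by (simp add: sum_negf)
  have "(\<Sum>a\<le>Suc m. (-1) ^ a * (\<Sum>b\<le>m. (-1) ^ b * G (omit b (omit a w)))) = sum ?t ?I"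
    unfolding sum_distrib_left by (rule sum.cartesian_product)
  also have "?I = ?L \<union> ?R"
    by auto
  also have "sum ?t (?L \<union> ?R) = sum ?t ?L + sum ?t ?R"
    by (rule sum.union_disjoint)
       (auto intro: finite_subset [where B = ?I])
  finally show ?thesis
    using cancel by simp
qed

section \<open>The sign of the shuffle moving one index to the end\<close>

lemma shuffle_perm_singleton:
  assumes "a \<in> {1..N}"
  shows "shuffle_perm N {a} i = (if a \<le> i \<and> i < N then Suc i else if i = N then a else i)"
proof -
  have "sorted_list_of_set ({1..N} - {a}) = [1..<a] @ [Suc a..<Suc N]"
    using assms
    by (intro sorted_distinct_set_unique) (auto simp: sorted_append)
  then show ?thesis
    using assms by (auto simp: shuffle_perm_def nth_append simp del: upt_Suc)
qed

text \<open>Lowering \<open>a\<close> by one multiplies the shuffle by one adjacent transposition, and for \<open>a = N\<close>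
  the shuffle is the identity.\<close>

lemma sign_shuffle_perm_singleton:
  assumes "a \<in> {1..N}"
  shows "sign (shuffle_perm N {a}) = (-1) ^ (N + a)"
proof -
  have "a \<le> N" "1 \<le> a" using assms by auto
  then have "permutation (shuffle_perm N {a}) \<and> sign (shuffle_perm N {a}) = (-1) ^ (N + a)"
  proof (induction a rule: inc_induct)
    case base
    then have "shuffle_perm N {N} = id"
      by (auto simp: fun_eq_iff shuffle_perm_singleton)
    then show ?case
      by (simp add: sign_id)
  next
    case (step a)
    have "shuffle_perm N {a} = Transposition.transpose a (Suc a) \<circ> shuffle_perm N {Suc a}"
      using step.hyps step.prems
      by (auto simp: fun_eq_iff shuffle_perm_singleton Transposition.transpose_def)
    then show ?case
      using step.IH
      by (simp add: permutation_compose permutation_swap_id sign_compose sign_swap_id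
          del: o_apply)
  qed
  then show ?thesis ..
qed

section \<open>The coboundary as an alternating face sum\<close>

lemma face1_in_cells:
  assumes "rack X op" and "z \<in> cells X (Suc k)" and "i \<in> {1..Suc k}"
  shows "face1 op i z \<in> cells X k"
proof -
  obtain y xs where z: "z = (y, xs)" "y \<in> X" "set xs \<subseteq> X" "length xs = Suc k"
    using assms(2) by (cases z) (auto simp: cells_def)
  have closed: "op a b \<in> X" if "a \<in> X" "b \<in> X" for a b
    using assms(1) that by (auto simp: rack_def)
  have "xs ! (i - 1) \<in> X"
    using z assms(3) by (intro subsetD [OF z(3)] nth_mem) auto
  then show ?thesis
    using z assms(3) closed
    by (auto simp: cells_def Let_def subset_iff dest: in_set_takeD in_set_dropD)
qed

text \<open>Larger indices are removed first, so each remaining index still points into the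
  shortened list.\<close>

lemma foldr_face1_in_cells:
  assumes "rack X op" and "z \<in> cells X (k + length l)"
    and "sorted_wrt (<) l" and "set l \<subseteq> {1..k + length l}"
  shows "foldr (face1 op) l z \<in> cells X k"
  using assms(2-)
proof (induction l arbitrary: k)
  case Nil
  then show ?case by simp
next
  case (Cons i l)
  have "card (set l) \<le> card {Suc i..k + length (i # l)}"
    using Cons.prems by (intro card_mono) (auto simp: Suc_le_eq)
  then have "i \<le> Suc k"
    using Cons.prems by (auto simp: strict_sorted_iff distinct_card)
  moreover have "foldr (face1 op) l z \<in> cells X (Suc k)"
    using Cons.prems by (intro Cons.IH) auto
  ultimately show ?case
    using Cons.prems assms(1) by (auto intro!: face1_in_cells)
qed

lemma faces1_in_cells:
  assumes "rack X op" and "z \<in> cells X (k + card B)" and "B \<subseteq> {1..k + card B}"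
  shows "faces1 op B z \<in> cells X k"
proof -
  have "finite B"
    using assms(3) finite_subset by blast
  then show ?thesis
    unfolding faces1_def using assms by (intro foldr_face1_in_cells) auto
qed

lemma Lam_cells:
  assumes "z \<in> cells X 1"
  shows "Lam X z = 1"
  using assms by (auto simp: cells_def length_Suc_conv intro!: Lam_eq_1)

text \<open>Here the rack operation disappears: it enters only through cells on which \<open>\<Lambda>\<close> is \<open>1\<close>.\<close>

lemma cup_Lam:
  fixes F :: "'a \<times> 'a list \<Rightarrow> 'r::comm_ring_1"
  assumes "rack X op" and "z \<in> cells X (n + 1)"
  shows "cup X op n 1 F (Lam X) z =
    (-1) ^ n * (\<Sum>a\<in>{1..n + 1}. (-1) ^ (n + 1 + a) * F (face0 a z))"
proof -
  let ?B = "\<lambda>a. {1..n + 1} - {a}"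
  have Lam: "Lam X (faces1 op (?B a) z) = (1 :: 'r)" if "a \<in> {1..n + 1}" for a
    using assms that by (intro Lam_cells faces1_in_cells) auto
  have summand: "of_int (sign (shuffle_perm (n + 1) {a})) *
      F (faces0 {a} z) * Lam X (faces1 op (?B a) z) = (-1) ^ (n + 1 + a) * F (face0 a z)"
    if "a \<in> {1..n + 1}" for a
    unfolding Lam [OF that] sign_shuffle_perm_singleton [OF that] by (simp add: faces0_def)
  have singletons: "{A. A \<subseteq> {1..n + 1} \<and> card A = 1} = (\<lambda>a. {a}) ` {1..n + 1}"
    by (auto simp: card_1_singleton_iff)
  have "cup X op n 1 F (Lam X) z = (-1) ^ n *
      (\<Sum>a\<in>{1..n + 1}. of_int (sign (shuffle_perm (n + 1) {a})) *
         F (faces0 {a} z) * Lam X (faces1 op (?B a) z))"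
    using assms(2) unfolding cup_def singletons by (subst sum.reindex) (auto simp: inj_on_def)
  also have "\<dots> = (-1) ^ n * (\<Sum>a\<in>{1..n + 1}. (-1) ^ (n + 1 + a) * F (face0 a z))"
    by (simp only: summand cong: sum.cong)
  finally show ?thesis .
qed

text \<open>In vertex lists \<open>x\<^sub>0\<close> stands on the same footing as the other entries; for \<open>a \<ge> 1\<close>, omitting
  position \<open>a\<close> is the face \<open>\<delta>\<^sup>0\<^sub>a\<close>, while omitting position \<open>0\<close> is the face used by \<open>P\<close>.\<close>

definition cell_of :: "'a list \<Rightarrow> 'a \<times> 'a list" where
  "cell_of w = (hd w, tl w)"

lemma cell_of_in_cells:
  "cell_of w \<in> cells X n" if "length w = n + 1" and "set w \<subseteq> X"
  using that by (cases w) (auto simp: cell_of_def cells_def)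

theorem Q_eq_alternating_sum:
  fixes F :: "'a \<times> 'a list \<Rightarrow> 'r::comm_ring_1"
  assumes "rack X op" and "length w = n + 2" and "set w \<subseteq> X"
  shows "Q X op n F (cell_of w) = (-1) ^ n * (\<Sum>a\<le>n + 1. (-1) ^ a * F (cell_of (omit a w)))"
proof -
  have z: "cell_of w \<in> cells X (n + 1)"
    using assms by (intro cell_of_in_cells) auto
  obtain y xs where w: "w = y # xs" "xs \<noteq> []"
    using assms(2) by (cases w) (auto intro: that)
  have face0: "face0 a (cell_of w) = cell_of (omit a w)" if "a \<in> {1..n + 1}" for a
    using that w by (cases a) (auto simp: cell_of_def omit_def)
  have "P X n F (cell_of w) = (-1) ^ n * F (cell_of (omit 0 w))"
    using z w by (simp add: P_def cell_of_def omit_def)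
  moreover have "(-1) ^ (n + 1) * cup X op n 1 F (Lam X) (cell_of w) =
      (-1) ^ n * (\<Sum>a\<in>{1..n + 1}. (-1) ^ a * F (cell_of (omit a w)))"
    unfolding cup_Lam [OF assms(1) z] sum_distrib_left
    by (intro sum.cong refl) (simp add: face0 power_add flip: power_mult_distrib mult.assoc)
  moreover have "{..n + 1} = insert 0 {1..n + 1}"
    by auto
  ultimately show ?thesis
    using z by (simp add: Q_def distrib_left)
qed

theorem proposition14:
  fixes X :: "'a set" and op :: "'a \<Rightarrow> 'a \<Rightarrow> 'a" and n :: nat
    and F :: "'a \<times> 'a list \<Rightarrow> 'r::comm_ring_1"
  assumes "rack X op" and "F \<in> cochains X n"
  shows "Q X op (n + 1) (Q X op n F) = zero_cochain X (n + 2)"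
proof
  fix z :: "'a \<times> 'a list"
  show "Q X op (n + 1) (Q X op n F) z = zero_cochain X (n + 2) z"
  proof (cases "z \<in> cells X (n + 2)")
    case False
    then show ?thesis by (simp add: Q_def zero_cochain_def)
  next
    case True
    define w where "w = fst z # snd z"
    have z: "z = cell_of w" and w: "length w = n + 3" "set w \<subseteq> X"
      using True by (auto simp: w_def cell_of_def cells_def)
    have face: "Q X op n F (cell_of (omit a w)) =
        (-1) ^ n * (\<Sum>b\<le>n + 1. (-1) ^ b * F (cell_of (omit b (omit a w))))"
      if "a \<le> n + 2" for a
      using that w set_omit_subset [of a w] assms(1)
      by (intro Q_eq_alternating_sum) (auto simp: length_omit)
    have "Q X op (n + 1) (Q X op n F) z =
        (-1) ^ (n + 1) * (\<Sum>a\<le>n + 2. (-1) ^ a * Q X op n F (cell_of (omit a w)))"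
      using Q_eq_alternating_sum [OF assms(1), of w "n + 1"] w by (simp add: z)
    also have "(\<Sum>a\<le>n + 2. (-1) ^ a * Q X op n F (cell_of (omit a w))) =
        (-1) ^ n *
          (\<Sum>a\<le>n + 2. (-1) ^ a * (\<Sum>b\<le>n + 1. (-1) ^ b * F (cell_of (omit b (omit a w)))))"
      unfolding sum_distrib_left [where r = "(-1) ^ n"]
      by (intro sum.cong refl) (simp add: face mult.left_commute)
    also have "(\<Sum>a\<le>n + 2. (-1) ^ a * (\<Sum>b\<le>n + 1. (-1) ^ b * F (cell_of (omit b (omit a w))))) = 0"
      using alternating_sum_omit_omit [of w "n + 1" "\<lambda>v. F (cell_of v)"] w by simp
    finally show ?thesis
      using True by (simp add: zero_cochain_def)
  qed
qed

end
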